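(* Suppose $V$ is a real-valued function analytic at $0$ with $V(0)=1$ and $V''(0)<-2$. Then $V$ cannot be a variance function of a free exponential family with $m_0=0$; that is, no compactly supported probability measure $\nu$ on $\mathbb{R}$ with mean $0$ generates a free exponential family with variance function $V$.
   Context: A compactly supported probability measure $\nu$ with mean $m_0$ generates the free exponential family with variance function $V$ if there is an open interval $(A,B)\ni m_0$ such that $V>0$ on $(A,B)$ and, for every $m\in(A,B)$, $Q_m(dx)=\frac{V(m)}{V(m)+(m-m_0)(m-x)}\,\nu(dx)$ is a probability measure with mean $m$ and variance $V(m)$. *)

theory Defs
  imports "HOL-Probability.Probability" "HOL-Analysis.FPS_Convergence"
begin

definition compactly_supported :: "real measure \<Rightarrow> bool" where
  "compactly_supported \<nu> \<longleftrightarrow> (\<exists>K. compact K \<and> (AE x in \<nu>. x \<in> K))"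

definition fef_density :: "(real \<Rightarrow> real) \<Rightarrow> real \<Rightarrow> real \<Rightarrow> real \<Rightarrow> real" where
  "fef_density V m\<^sub>0 m x = V m / (V m + (m - m\<^sub>0) * (m - x))"

definition fef_measure :: "(real \<Rightarrow> real) \<Rightarrow> real \<Rightarrow> real measure \<Rightarrow> real \<Rightarrow> real measure" where
  "fef_measure V m\<^sub>0 \<nu> m = density \<nu> (\<lambda>x. ennreal (fef_density V m\<^sub>0 m x))"

text \<open>
  Since \<open>ennreal\<close> truncates negative reals and \<open>x / 0 = 0\<close>, the measure
  \<open>fef_measure V m\<^sub>0 \<nu> m\<close> agrees with the formula for \<open>Q\<^sub>m\<close> only if the
  denominator is nonzero and the density nonnegative almost everywhere; both are part of the
  requirement that \<open>Q\<^sub>m\<close> be a probability measure. The identity function is integrable,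
  and so is its square, for \<open>\<nu>\<close> and all \<open>Q\<^sub>m\<close> by compactness of the support.
  The conditions are inherited by smaller intervals around \<open>m\<^sub>0\<close>, so finite endpoints
  suffice.
\<close>

definition generates_free_exp_family ::
    "real measure \<Rightarrow> real \<Rightarrow> (real \<Rightarrow> real) \<Rightarrow> bool" where
  "generates_free_exp_family \<nu> m\<^sub>0 V \<longleftrightarrow>
     real_distribution \<nu> \<and> compactly_supported \<nu> \<and>
     prob_space.expectation \<nu> (\<lambda>x. x) = m\<^sub>0 \<and>
     (\<exists>A B. m\<^sub>0 \<in> {A<..<B} \<and>
        (\<forall>m\<in>{A<..<B}. V m > 0 \<and>
           (AE x in \<nu>. V m + (m - m\<^sub>0) * (m - x) \<noteq> 0 \<and> fef_density V m\<^sub>0 m x \<ge> 0) \<and>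
           prob_space (fef_measure V m\<^sub>0 \<nu> m) \<and>
           prob_space.expectation (fef_measure V m\<^sub>0 \<nu> m) (\<lambda>x. x) = m \<and>
           prob_space.variance (fef_measure V m\<^sub>0 \<nu> m) (\<lambda>x. x) = V m))"

definition real_analytic_at_0 :: "(real \<Rightarrow> real) \<Rightarrow> bool" where
  "real_analytic_at_0 V \<longleftrightarrow> (\<exists>F. V has_fps_expansion F)"

end

theory Submission imports Defs begin

text \<open>
  Multiplying the density of \<open>Q\<^sub>m\<close> by its denominator gives the recursion
  \<open>(m - m\<^sub>0) M\<^sub>k\<^sub>+\<^sub>1 = (V m + (m - m\<^sub>0) m) M\<^sub>k - V m \<mu>\<^sub>k\<close> between the moments
  \<open>M\<^sub>k\<close> of \<open>Q\<^sub>m\<close> and \<open>\<mu>\<^sub>k\<close> of \<open>\<nu>\<close>. As the \<open>M\<^sub>k\<close> stay bounded, it forces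
  \<open>M\<^sub>k \<longlonglongrightarrow> \<mu>\<^sub>k\<close> when \<open>m\<close> tends to \<open>m\<^sub>0\<close>; starting from \<open>M\<^sub>1 = m\<close>, it therefore determines all
  moments of \<open>\<nu>\<close> from the Taylor coefficients of \<open>V\<close>. If \<open>m\<^sub>0 = 0\<close> and \<open>V m = 1 + a m + b m\<^sup>2 + \<dots>\<close>,
  then \<open>\<mu>\<^sub>2 = 1\<close>, \<open>\<mu>\<^sub>3 = a\<close> and \<open>\<mu>\<^sub>4 = a\<^sup>2 + b + 2\<close>, so that the integral of
  \<open>(x\<^sup>2 - a x - 1)\<^sup>2\<close> with respect to \<open>\<nu>\<close> is \<open>b + 1\<close>, whence \<open>b \<ge> -1\<close>.
\<close>

section \<open>Moments of almost surely bounded random variables\<close>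

lemma (in prob_space) integrable_power_AE_bounded:
  fixes R :: real
  assumes "X \<in> borel_measurable M" "AE x in M. \<bar>X x\<bar> \<le> R"
  shows "integrable M (\<lambda>x. X x ^ k)"
proof (rule integrable_const_bound)
  show "AE x in M. norm (X x ^ k) \<le> R ^ k"
    using assms(2) by eventually_elim (simp add: power_abs power_mono)
qed (use assms(1) in measurable)

text \<open>The bound depends on \<open>R\<close> and \<open>k\<close> alone, not on the probability
  measure, so it serves all the measures \<open>fef_measure V m\<^sub>0 \<nu> m\<close> at
  once.\<close>

lemma (in prob_space) abs_expectation_power_le:
  fixes R :: real
  assumes "X \<in> borel_measurable M" "AE x in M. \<bar>X x\<bar> \<le> R"
  shows "\<bar>expectation (\<lambda>x. X x ^ k)\<bar> \<le> R ^ k"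
proof -
  have "\<bar>expectation (\<lambda>x. X x ^ k)\<bar> \<le> expectation (\<lambda>x. \<bar>X x ^ k\<bar>)"
    by (rule integral_abs_bound)
  also have "\<dots> \<le> R ^ k"
  proof (rule integral_le_const)
    show "integrable M (\<lambda>x. \<bar>X x ^ k\<bar>)"
      by (intro integrable_abs integrable_power_AE_bounded[OF assms])
    show "AE x in M. \<bar>X x ^ k\<bar> \<le> R ^ k"
      using assms(2) by eventually_elim (simp add: power_abs power_mono)
  qed
  finally show ?thesis .
qed

section \<open>Second-order expansion of an analytic function\<close>

lemma has_fps_expansion_nth_0:
  fixes F :: "'a :: {banach, real_normed_field} fps"
  assumes "f has_fps_expansion F"
  shows "f 0 = fps_nth F 0"
proof -
  have "\<forall>\<^sub>F z in nhds 0. eval_fps F z = f z"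
    using assms by (simp add: has_fps_expansion_def)
  then have "eval_fps F 0 = f 0"
    by (rule eventually_nhds_x_imp_x)
  then show ?thesis
    by (simp add: eval_fps_at_0)
qed

text \<open>Removing the first two terms leaves a power series divisible by the square of the
  variable. The quotient series has constant coefficient \<open>fps_nth F 2\<close>, half the second
  derivative, and its sum is continuous at 0.\<close>

lemma has_fps_expansion_Peano_2:
  fixes F :: "real fps"
  assumes "f has_fps_expansion F"
  shows "((\<lambda>x. (f x - f 0 - deriv f 0 * x) / x ^ 2) \<longlongrightarrow> deriv (deriv f) 0 / 2) (at 0)"
proof -
  note d1 = has_fps_expansion_deriv[OF assms]
  have coeffs: "f 0 = fps_nth F 0" "deriv f 0 = fps_nth F 1" "deriv (deriv f) 0 = 2 * fps_nth F 2"
    using has_fps_expansion_nth_0[OF assms] has_fps_expansion_nth_0[OF d1]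
      has_fps_expansion_nth_0[OF has_fps_expansion_deriv[OF d1]]
    by (simp_all add: numeral_2_eq_2)
  define G where "G = F - fps_const (f 0) - fps_const (deriv f 0) * fps_X"
  have nth_G: "fps_nth G n = (if n \<le> 1 then 0 else fps_nth F n)" for n
    by (cases n rule: nat.exhaust; cases "n = 1") (auto simp: G_def coeffs)
  have G: "(\<lambda>x. f x - f 0 - deriv f 0 * x) has_fps_expansion G"
    unfolding G_def by (intro fps_expansion_intros assms)
  \<comment> \<open>Division by zero yields 0, so the value at the origin is patched to the one that
    makes the quotient continuous.\<close>
  have "(\<lambda>x. if x = 0 then fps_nth F 2 else (f x - f 0 - deriv f 0 * x) / x ^ 2)
    has_fps_expansion fps_shift 2 G" (is "?h has_fps_expansion _")
  proof (cases "G = 0")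
    \<comment> \<open>The zero series has subdegree 0 by convention, so the shift rule, which asks
      for subdegree at least 2, does not cover it.\<close>
    case True
    then have "fps_nth F 2 = 0"
      using nth_G[of 2] by simp
    have "\<forall>\<^sub>F x in nhds 0. eval_fps G x = f x - f 0 - deriv f 0 * x"
      using G unfolding has_fps_expansion_def by (rule conjunct2)
    then have "\<forall>\<^sub>F x in nhds 0. eval_fps (fps_shift 2 G) x = ?h x"
      by eventually_elim (simp add: True \<open>fps_nth F 2 = 0\<close>)
    then show ?thesis
      by (simp add: has_fps_expansion_def True)
  next
    case False
    show ?thesis
      by (rule has_fps_expansion_shift[OF G]) (auto intro!: subdegree_geI False simp: nth_G)
  qed
  then have "(?h \<longlongrightarrow> ?h 0) (at 0)"
    using has_fps_expansion_imp_continuous[of ?h _ UNIV] by (simp only: continuous_within)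
  then show ?thesis
    by (subst Lim_cong_within[OF refl refl refl, where g = ?h]) (auto simp: coeffs)
qed

section \<open>The measures of the family and their moments\<close>

lemma sets_fef_measure [measurable_cong, simp]: "sets (fef_measure V m\<^sub>0 \<nu> m) = sets \<nu>"
  by (simp add: fef_measure_def)

lemma fef_density_measurable [measurable]: "fef_density V m\<^sub>0 m \<in> borel_measurable borel"
  unfolding fef_density_def by measurable

text \<open>A measure with a density is absolutely continuous; this carries the bound on the support
  of \<open>\<nu>\<close> over to the whole family.\<close>

lemma AE_fef_measure:
  assumes "sets \<nu> = sets borel" "AE x in \<nu>. P x"
  shows "AE x in fef_measure V m\<^sub>0 \<nu> m. P x"
  unfolding fef_measure_def
  by (subst AE_density) (use assms in \<open>auto cong: measurable_cong_sets\<close>)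

text \<open>In \<open>dens\<close>, nonnegativity ensures that \<open>ennreal\<close> does not
  truncate the density, and the nonzero denominator allows it to be cancelled.\<close>

lemma fef_moment_Suc:
  fixes R :: real
  assumes \<nu>: "real_distribution \<nu>"
    and bdd: "AE x in \<nu>. \<bar>x\<bar> \<le> R"
    and dens: "AE x in \<nu>. V m + (m - m\<^sub>0) * (m - x) \<noteq> 0 \<and> fef_density V m\<^sub>0 m x \<ge> 0"
    and Q: "prob_space (fef_measure V m\<^sub>0 \<nu> m)"
  shows "(m - m\<^sub>0) * (\<integral>x. x ^ Suc k \<partial>fef_measure V m\<^sub>0 \<nu> m) =
    (V m + (m - m\<^sub>0) * m) * (\<integral>x. x ^ k \<partial>fef_measure V m\<^sub>0 \<nu> m) - V m * (\<integral>x. x ^ k \<partial>\<nu>)"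
proof -
  interpret real_distribution \<nu> by fact
  interpret Q: prob_space "fef_measure V m\<^sub>0 \<nu> m" by fact
  let ?f = "fef_density V m\<^sub>0 m"
  have nonneg: "AE x in \<nu>. 0 \<le> ?f x"
    using dens by eventually_elim simp
  have bddQ: "AE x in fef_measure V m\<^sub>0 \<nu> m. \<bar>x\<bar> \<le> R"
    by (rule AE_fef_measure[OF _ bdd]) simp
  have meas: "?f \<in> borel_measurable \<nu>"
    by simp
  have moment: "(\<integral>x. x ^ k \<partial>fef_measure V m\<^sub>0 \<nu> m) = (\<integral>x. ?f x * x ^ k \<partial>\<nu>)" for k
    unfolding fef_measure_def by (rule integral_real_density[OF meas nonneg]) simp
  \<comment> \<open>Integrability is read off from the almost sure bound under the new measure, as
    the density itself comes with no bound.\<close>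
  have int: "integrable \<nu> (\<lambda>x. ?f x * x ^ k)" for k
  proof -
    have "integrable (fef_measure V m\<^sub>0 \<nu> m) (\<lambda>x. x ^ k)"
      by (rule Q.integrable_power_AE_bounded[OF _ bddQ]) simp
    then show ?thesis
      unfolding fef_measure_def by (subst (asm) integrable_real_density[OF meas nonneg]) simp_all
  qed
  have int\<nu>: "integrable \<nu> (\<lambda>x. x ^ k)"
    by (rule integrable_power_AE_bounded[OF _ bdd]) simp
  have "(m - m\<^sub>0) * (\<integral>x. ?f x * x ^ Suc k \<partial>\<nu>) = (\<integral>x. (m - m\<^sub>0) * (?f x * x ^ Suc k) \<partial>\<nu>)"
    by simp
  also have "\<dots> = (\<integral>x. (V m + (m - m\<^sub>0) * m) * (?f x * x ^ k) - V m * x ^ k \<partial>\<nu>)"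
  proof (rule integral_cong_AE)
    show "AE x in \<nu>. (m - m\<^sub>0) * (?f x * x ^ Suc k) =
      (V m + (m - m\<^sub>0) * m) * (?f x * x ^ k) - V m * x ^ k"
      using dens
    proof eventually_elim
      case (elim x)
      then have "?f x * (V m + (m - m\<^sub>0) * (m - x)) = V m"
        by (simp add: fef_density_def)
      then have "(?f x * (V m + (m - m\<^sub>0) * (m - x))) * x ^ k = V m * x ^ k"
        by simp
      then show ?case
        by (simp add: algebra_simps)
    qed
  qed (use meas in measurable)
  also have "\<dots> = (V m + (m - m\<^sub>0) * m) * (\<integral>x. ?f x * x ^ k \<partial>\<nu>) - V m * (\<integral>x. x ^ k \<partial>\<nu>)"
    using int[of k] int\<nu> by simp
  finally show ?thesis
    by (simp only: moment)
qed

text \<open>Solved for the \<open>k\<close>-th moment, the recursion contains the next moment only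
  with the factor \<open>m - m\<^sub>0\<close>. Boundedness of that moment suffices, so no induction
  on \<open>k\<close> arises.\<close>

lemma fef_moment_tendsto:
  fixes R :: real
  assumes \<nu>: "real_distribution \<nu>"
    and bdd: "AE x in \<nu>. \<bar>x\<bar> \<le> R"
    and dens: "\<forall>\<^sub>F m in at m\<^sub>0.
      AE x in \<nu>. V m + (m - m\<^sub>0) * (m - x) \<noteq> 0 \<and> fef_density V m\<^sub>0 m x \<ge> 0"
    and Q: "\<forall>\<^sub>F m in at m\<^sub>0. prob_space (fef_measure V m\<^sub>0 \<nu> m)"
    and V: "isCont V m\<^sub>0" "V m\<^sub>0 \<noteq> 0"
  shows "((\<lambda>m. \<integral>x. x ^ k \<partial>fef_measure V m\<^sub>0 \<nu> m) \<longlongrightarrow> (\<integral>x. x ^ k \<partial>\<nu>)) (at m\<^sub>0)"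
proof -
  interpret real_distribution \<nu> by fact
  define M where "M k m = (\<integral>x. x ^ k \<partial>fef_measure V m\<^sub>0 \<nu> m)" for k m
  define c where "c m = V m + (m - m\<^sub>0) * m" for m
  have V_lim: "(V \<longlongrightarrow> V m\<^sub>0) (at m\<^sub>0)"
    using V(1) by (simp add: isCont_def)
  have "(c \<longlongrightarrow> V m\<^sub>0 + (m\<^sub>0 - m\<^sub>0) * m\<^sub>0) (at m\<^sub>0)"
    unfolding c_def by (intro tendsto_intros V_lim)
  then have c_lim: "(c \<longlongrightarrow> V m\<^sub>0) (at m\<^sub>0)"
    by simp
  have "\<forall>\<^sub>F m in at m\<^sub>0. norm (M (Suc k) m) \<le> R ^ Suc k"
    using Q
  proof eventually_elim
    case (elim m)
    have "AE x in fef_measure V m\<^sub>0 \<nu> m. \<bar>x\<bar> \<le> R"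
      by (rule AE_fef_measure[OF _ bdd]) simp
    from prob_space.abs_expectation_power_le[OF elim _ this, of "Suc k"] show ?case
      by (simp add: M_def)
  qed
  then have "Bfun (M (Suc k)) (at m\<^sub>0)"
    by (rule BfunI)
  moreover have "Zfun (\<lambda>m. m - m\<^sub>0) (at m\<^sub>0)"
    by (simp add: tendsto_Zfun_iff[symmetric] tendsto_ident_at)
  ultimately have "Zfun (\<lambda>m. (m - m\<^sub>0) * M (Suc k) m) (at m\<^sub>0)"
    by (intro bounded_bilinear.Zfun_prod_Bfun[OF bounded_bilinear_mult])
  then have "((\<lambda>m. (m - m\<^sub>0) * M (Suc k) m) \<longlongrightarrow> 0) (at m\<^sub>0)"
    by (simp add: tendsto_Zfun_iff)
  then have "((\<lambda>m. ((m - m\<^sub>0) * M (Suc k) m + V m * (\<integral>x. x ^ k \<partial>\<nu>)) / c m)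
      \<longlongrightarrow> (0 + V m\<^sub>0 * (\<integral>x. x ^ k \<partial>\<nu>)) / V m\<^sub>0) (at m\<^sub>0)"
    by (intro tendsto_intros V_lim c_lim V(2))
  moreover have "\<forall>\<^sub>F m in at m\<^sub>0.
      ((m - m\<^sub>0) * M (Suc k) m + V m * (\<integral>x. x ^ k \<partial>\<nu>)) / c m = M k m"
    using dens Q tendsto_imp_eventually_ne[OF c_lim V(2)]
  proof eventually_elim
    case (elim m)
    then show ?case
      using fef_moment_Suc[OF \<nu> bdd elim(1,2), of k] by (simp add: M_def c_def)
  qed
  ultimately have "(M k \<longlongrightarrow> (0 + V m\<^sub>0 * (\<integral>x. x ^ k \<partial>\<nu>)) / V m\<^sub>0) (at m\<^sub>0)"
    by (rule Lim_transform_eventually)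
  then show ?thesis
    using V(2) by (simp add: M_def[abs_def])
qed

section \<open>The first four moments and the contradiction\<close>

theorem corollary3p6:
  fixes V :: "real \<Rightarrow> real"
  assumes "real_analytic_at_0 V"
    and "V 0 = 1"
    and "deriv (deriv V) 0 < - 2"
  shows "\<not> (\<exists>\<nu> :: real measure. generates_free_exp_family \<nu> 0 V)"
proof
  assume "\<exists>\<nu> :: real measure. generates_free_exp_family \<nu> 0 V"
  then obtain \<nu> :: "real measure" where "generates_free_exp_family \<nu> 0 V" ..
  then obtain A B K where \<nu>: "real_distribution \<nu>" and K: "compact K" "AE x in \<nu>. x \<in> K"
    and mean: "prob_space.expectation \<nu> (\<lambda>x. x) = 0" and AB: "0 \<in> {A<..<B}"
    and fef: "\<And>m. m \<in> {A<..<B} \<Longrightarrow>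
      (AE x in \<nu>. V m + (m - 0) * (m - x) \<noteq> 0 \<and> fef_density V 0 m x \<ge> 0) \<and>
      prob_space (fef_measure V 0 \<nu> m) \<and>
      prob_space.expectation (fef_measure V 0 \<nu> m) (\<lambda>x. x) = m"
    unfolding generates_free_exp_family_def compactly_supported_def by blast
  interpret real_distribution \<nu> by fact
  obtain R where "\<forall>x\<in>K. norm x \<le> R"
    using compact_imp_bounded[OF K(1)] by (auto simp: bounded_iff)
  then have bdd: "AE x in \<nu>. \<bar>x\<bar> \<le> R"
    using K(2) by auto
  obtain F where F: "V has_fps_expansion F"
    using assms(1) by (auto simp: real_analytic_at_0_def)
  have "isCont V 0"
    by (rule has_fps_expansion_imp_continuous[OF F])
  then have V_lim: "(V \<longlongrightarrow> 1) (at 0)"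
    using assms(2) by (simp add: isCont_def)
  define a where "a = deriv V 0"
  define b where "b = deriv (deriv V) 0 / 2"
  \<comment> \<open>With this remainder quotient the Taylor formula \<open>V_eq\<close> is exact for
    \<open>m \<noteq> 0\<close>, and the moments become polynomials in \<open>V m\<close>,
    \<open>w m\<close>, \<open>a\<close> and \<open>m\<close>. The default value at 0 is invisible
    to limits along \<open>at 0\<close>.\<close>
  define w where "w m = (V m - 1 - a * m) / m ^ 2" for m
  have w_lim: "(w \<longlongrightarrow> b) (at 0)"
    using has_fps_expansion_Peano_2[OF F] assms(2) by (simp add: w_def[abs_def] a_def b_def)
  define \<mu> where "\<mu> k = (\<integral>x. x ^ k \<partial>\<nu>)" for k
  define M where "M k m = (\<integral>x. x ^ k \<partial>fef_measure V 0 \<nu> m)" for k m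
  have near: "\<forall>\<^sub>F m in at 0. m \<in> {A<..<B}"
    using AB by (intro eventually_at_in_open') auto
  have M_lim: "(M k \<longlongrightarrow> \<mu> k) (at 0)" for k
    unfolding M_def \<mu>_def
  proof (rule fef_moment_tendsto[OF \<nu> bdd _ _ \<open>isCont V 0\<close>])
    show "\<forall>\<^sub>F m in at 0. AE x in \<nu>. V m + (m - 0) * (m - x) \<noteq> 0 \<and> fef_density V 0 m x \<ge> 0"
      using near by eventually_elim (use fef in blast)
    show "\<forall>\<^sub>F m in at 0. prob_space (fef_measure V 0 \<nu> m)"
      using near by eventually_elim (use fef in blast)
  qed (simp add: assms(2))
  have rec: "m * M (Suc k) m = (V m + m ^ 2) * M k m - V m * \<mu> k" if "m \<in> {A<..<B}" for k m
    using fef_moment_Suc[OF \<nu> bdd, of V m 0 k] fef[OF that]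
    by (simp add: M_def \<mu>_def power2_eq_square)
  have \<mu>0: "\<mu> 0 = 1" and \<mu>1: "\<mu> 1 = 0"
    using mean prob_space by (simp_all add: \<mu>_def)
  have M1: "M 1 m = m" if "m \<in> {A<..<B}" for m
    using fef[OF that] by (simp add: M_def)
  have M2: "M 2 m = V m + m ^ 2" if "m \<in> {A<..<B}" "m \<noteq> 0" for m
    using rec[OF that(1), of 1] M1[OF that(1)] \<mu>1 that(2) by (simp add: numeral_2_eq_2)
  have V_eq: "V m = 1 + a * m + w m * m ^ 2" if "m \<noteq> 0" for m
    using that by (simp add: w_def)

  \<comment> \<open>The pattern for orders 2, 3 and 4: the explicit formula for \<open>M k\<close>
    has a limit at 0, which must agree with the one from \<open>M_lim\<close>.\<close>
  have "((\<lambda>m. V m + m ^ 2) \<longlongrightarrow> 1 + 0 ^ 2) (at 0)"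
    by (intro tendsto_intros V_lim)
  moreover have "\<forall>\<^sub>F m in at 0. V m + m ^ 2 = M 2 m"
    using near eventually_neq_at_within[of 0] by eventually_elim (simp add: M2)
  ultimately have "(M 2 \<longlongrightarrow> 1 + 0 ^ 2) (at 0)"
    by (rule Lim_transform_eventually)
  from tendsto_unique[OF _ M_lim this] have \<mu>2: "\<mu> 2 = 1"
    by simp

  have M3: "M 3 m = V m * (a + w m * m) + 2 * V m * m + m ^ 3"
    if m: "m \<in> {A<..<B}" "m \<noteq> 0" for m
  proof -
    have "m * M 3 m = (V m + m ^ 2) * (V m + m ^ 2) - V m"
      using rec[OF m(1), of 2] M2[OF m] \<mu>2 by (simp add: eval_nat_numeral)
    \<comment> \<open>Isolating \<open>V m - 1\<close> exposes the factor \<open>m\<close> to be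
      cancelled.\<close>
    also have "\<dots> = V m * (V m - 1) + 2 * V m * m ^ 2 + m ^ 4"
      by algebra
    also have "V m - 1 = m * (a + w m * m)"
      using V_eq[OF m(2)] by algebra
    finally have "m * M 3 m = m * (V m * (a + w m * m) + 2 * V m * m + m ^ 3)"
      by algebra
    then show ?thesis
      using m(2) by simp
  qed
  have "((\<lambda>m. V m * (a + w m * m) + 2 * V m * m + m ^ 3)
      \<longlongrightarrow> 1 * (a + b * 0) + 2 * 1 * 0 + 0 ^ 3) (at 0)"
    by (intro tendsto_intros V_lim w_lim)
  moreover have "\<forall>\<^sub>F m in at 0. V m * (a + w m * m) + 2 * V m * m + m ^ 3 = M 3 m"
    using near eventually_neq_at_within[of 0] by eventually_elim (simp add: M3)
  ultimately have "(M 3 \<longlongrightarrow> 1 * (a + b * 0) + 2 * 1 * 0 + 0 ^ 3) (at 0)"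
    by (rule Lim_transform_eventually)
  from tendsto_unique[OF _ M_lim this] have \<mu>3: "\<mu> 3 = a"
    by simp

  have M4: "M 4 m = V m * (w m + (a + w m * m) ^ 2) + 3 * V m ^ 2 + 3 * V m * m ^ 2 + m ^ 4 - V m"
    (is "_ = ?r m") if m: "m \<in> {A<..<B}" "m \<noteq> 0" for m
  proof -
    have "m * M 4 m = (V m + m ^ 2) * M 3 m - V m * a"
      using rec[OF m(1), of 3] \<mu>3 by (simp add: eval_nat_numeral)
    \<comment> \<open>The terms of order zero combine to \<open>V m * a * (V m - 1)\<close>,
      divisible by \<open>m\<close> through \<open>V_eq\<close>. The same relation turns
      \<open>m * V m * (a + w m * m)\<close> into \<open>V m ^ 2 - V m\<close>.\<close>
    then have "m * (m * M 4 m) = m * ?r m * m"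
      unfolding M3[OF m] using V_eq[OF m(2)] by algebra
    then show ?thesis
      using m(2) by simp
  qed
  have "((\<lambda>m. V m * (w m + (a + w m * m) ^ 2) + 3 * V m ^ 2 + 3 * V m * m ^ 2 + m ^ 4 - V m)
      \<longlongrightarrow> 1 * (b + (a + b * 0) ^ 2) + 3 * 1 ^ 2 + 3 * 1 * 0 ^ 2 + 0 ^ 4 - 1) (at 0)"
    by (intro tendsto_intros V_lim w_lim)
  moreover have "\<forall>\<^sub>F m in at 0.
      V m * (w m + (a + w m * m) ^ 2) + 3 * V m ^ 2 + 3 * V m * m ^ 2 + m ^ 4 - V m = M 4 m"
    using near eventually_neq_at_within[of 0] by eventually_elim (simp add: M4)
  ultimately have
    "(M 4 \<longlongrightarrow> 1 * (b + (a + b * 0) ^ 2) + 3 * 1 ^ 2 + 3 * 1 * 0 ^ 2 + 0 ^ 4 - 1) (at 0)"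
    by (rule Lim_transform_eventually)
  from tendsto_unique[OF _ M_lim this] have \<mu>4: "\<mu> 4 = b + a ^ 2 + 2"
    by simp

  have int: "integrable \<nu> (\<lambda>x. x ^ k)" for k
    by (rule integrable_power_AE_bounded[OF _ bdd]) simp
  \<comment> \<open>By the values of the first three moments, this quadratic is orthogonal to 1 and
    \<open>x\<close> in the square-integrable functions of \<open>\<nu>\<close>: it is the monic
    orthogonal polynomial of degree 2.\<close>
  have "0 \<le> (\<integral>x. (x ^ 2 - a * x - 1) ^ 2 \<partial>\<nu>)"
    by simp
  \<comment> \<open>The powers \<open>x ^ 1\<close> and \<open>x ^ 0\<close> are kept so that every
    summand integrates to a multiple of some \<open>\<mu> k\<close>.\<close>
  also have "\<dots> = (\<integral>x. x ^ 4 - 2 * a * x ^ 3 + (a ^ 2 - 2) * x ^ 2 + 2 * a * x ^ 1 + x ^ 0 \<partial>\<nu>)"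
    by (intro Bochner_Integration.integral_cong refl) algebra
  also have "\<dots> = \<mu> 4 - 2 * a * \<mu> 3 + (a ^ 2 - 2) * \<mu> 2 + 2 * a * \<mu> 1 + \<mu> 0"
    unfolding \<mu>_def by (simp only: int Bochner_Integration.integral_add
      Bochner_Integration.integral_diff Bochner_Integration.integrable_add
      Bochner_Integration.integrable_diff integrable_mult_right integral_mult_right_zero)
  also have "\<dots> = b + 1"
    unfolding \<mu>0 \<mu>1 \<mu>2 \<mu>3 \<mu>4 by algebra
  finally show False
    using assms(3) by (simp add: b_def)
qed

end
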